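(* Let $\mathcal{P}$ be a matrix polynomial (a polynomial in the scalar indeterminate $\mu$ with coefficients in $\mathbb{C}^{2\times 2}$), and let $\mu_1,\mu_2\in\mathbb{C}$ be two independent roots of $\det\mathcal{P}$. Then $\mathcal{P}$ has a unique right factor of the form $\mu-u$ with $u\in\mathbb{C}^{2\times2}$ such that $\mu_1,\mu_2$ are the roots of $\det(\mu-u)$. Moreover, if $y_i$ is a non-vanishing column of $\operatorname{adj}\mathcal{P}(\mu_i)$ for $i=1,2$ and $Y=\begin{pmatrix}y_1&y_2\end{pmatrix}$ is the corresponding basis, then $$u=Y\begin{pmatrix}\mu_1&0\\0&\mu_2\end{pmatrix}Y^{-1}.$$
   Context: A matrix polynomial is $\mathcal{P}=\begin{pmatrix}a&b\\c&d\end{pmatrix}$ with $a,b,c,d\in\mathbb{C}[\mu]$; equivalently $\mathcal{P}=\sum_{i=0}^n\mu^iC_i$ with $C_i\in\mathbb{C}^{2\times2}$. The indeterminate $\mu$ commutes with the coefficients. A scalar stands for the corresponding multiple of the identity matrix, so $\mu-u=\mu\cdot 1-u$. A matrix polynomial $\mathcal{R}$ is a right factor of $\mathcal{P}$ if there is a matrix polynomial $\mathcal{Q}$ with $\mathcal{P}=\mathcal{Q}\mathcal{R}$. The adjugate is $\operatorname{adj}\begin{pmatrix}a&b\\c&d\end{pmatrix}=\begin{pmatrix}d&-b\\-c&a\end{pmatrix}$. Two roots $\mu_1,\mu_2\in\mathbb{C}$ of $\det\mathcal{P}$ are called independent if $\ker\mathcal{P}(\mu_1)\cap\ker\mathcal{P}(\mu_2)=\{(0,0)\}$.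 (For independent roots, $\operatorname{adj}\mathcal{P}(\mu_1)$ and $\operatorname{adj}\mathcal{P}(\mu_2)$ have linearly independent columns $y_1$ and $y_2$, so that $Y$ is invertible.) *)

theory Defs
  imports "HOL-Analysis.Analysis" "HOL-Computational_Algebra.Polynomial"
begin

type_synonym matrix_poly = "complex poly ^ 2 ^ 2"

definition eval_matrix_poly :: "matrix_poly \<Rightarrow> complex \<Rightarrow> complex ^ 2 ^ 2" where
  "eval_matrix_poly P z = map_matrix (\<lambda>p. poly p z) P"

definition right_factor :: "matrix_poly \<Rightarrow> matrix_poly \<Rightarrow> bool" where
  "right_factor R P \<longleftrightarrow> (\<exists>Q. P = Q ** R)"

text \<open>The linear matrix polynomial \<open>\<mu> - u = \<mu> \<cdot> 1 - u\<close>: the polynomial \<open>[:0, 1:]\<close> is the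
  indeterminate \<open>\<mu>\<close>, and \<open>[:c:]\<close> is the constant polynomial \<open>c\<close>.\<close>

definition indet_minus :: "complex ^ 2 ^ 2 \<Rightarrow> matrix_poly" where
  "indet_minus u = mat [:0, 1:] - map_matrix (\<lambda>c. [:c:]) u"

definition adj :: "'a::comm_ring_1 ^ 2 ^ 2 \<Rightarrow> 'a ^ 2 ^ 2" where
  "adj A = vector [vector [A $ 2 $ 2, - (A $ 1 $ 2)], vector [- (A $ 2 $ 1), A $ 1 $ 1]]"

definition ker :: "complex ^ 2 ^ 2 \<Rightarrow> (complex ^ 2) set" where
  "ker A = {v. A *v v = 0}"

definition roots :: "complex poly \<Rightarrow> complex set" where
  "roots p = {z. poly p z = 0}"

definition independent_roots :: "matrix_poly \<Rightarrow> complex \<Rightarrow> complex \<Rightarrow> bool" where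
  "independent_roots P \<mu>\<^sub>1 \<mu>\<^sub>2 \<longleftrightarrow>
     \<mu>\<^sub>1 \<in> roots (det P) \<and> \<mu>\<^sub>2 \<in> roots (det P) \<and>
     ker (eval_matrix_poly P \<mu>\<^sub>1) \<inter> ker (eval_matrix_poly P \<mu>\<^sub>2) = {0}"

text \<open>HOL-Analysis matrices are vectors of rows, hence the transposition.\<close>

definition mat_of_columns :: "complex ^ 2 \<Rightarrow> complex ^ 2 \<Rightarrow> complex ^ 2 ^ 2" where
  "mat_of_columns y\<^sub>1 y\<^sub>2 = transpose (vector [y\<^sub>1, y\<^sub>2])"

definition diag2 :: "complex \<Rightarrow> complex \<Rightarrow> complex ^ 2 ^ 2" where
  "diag2 a b = vector [vector [a, 0], vector [0, b]]"

end

theory Submission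
  imports Defs
begin

text \<open>
  The columns of \<open>adj P(\<mu>\<^sub>i)\<close> lie in \<open>ker P(\<mu>\<^sub>i)\<close>, and independence makes both kernels lines that
  together span the plane. If \<open>\<mu> - u\<close> is a right factor, the eigenvectors of \<open>u\<close> lie in these
  lines, so \<open>u Y = Y diag(\<mu>\<^sub>1, \<mu>\<^sub>2)\<close> for any \<open>Y\<close> whose columns span the two lines. Conversely, the
  \<open>i\<close>-th column of \<open>P Y\<close> vanishes at \<open>\<mu>\<^sub>i\<close>, so \<open>P Y = Q diag(\<mu> - \<mu>\<^sub>1, \<mu> - \<mu>\<^sub>2)\<close>, and multiplying by
  \<open>Y\<^sup>-\<^sup>1\<close> on the right exhibits the factor \<open>\<mu> - u\<close> of \<open>P\<close>.
\<close>

lemmas matrix2_simps = vec_eq_iff forall_2 matrix_matrix_mult_def matrix_vector_mult_def sum_2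

lemma matrix_sub_ldistrib:
  fixes A :: "'a::ring_1 ^ 'n ^ 'm"
  shows "A ** (B - C) = A ** B - A ** C"
  by (simp add: vec_eq_iff matrix_matrix_mult_def right_diff_distrib sum_subtractf)

lemma matrix_sub_rdistrib:
  fixes A :: "'a::ring_1 ^ 'n ^ 'm"
  shows "(A - B) ** C = A ** C - B ** C"
  by (simp add: vec_eq_iff matrix_matrix_mult_def left_diff_distrib sum_subtractf)

lemma eval_matrix_poly_mult:
  "eval_matrix_poly (P ** Q) z = eval_matrix_poly P z ** eval_matrix_poly Q z"
  by (simp add: eval_matrix_poly_def map_matrix_def matrix2_simps)

lemma det_eval_matrix_poly: "det (eval_matrix_poly P z) = poly (det P) z"
  by (simp add: eval_matrix_poly_def map_matrix_def det_2)

lemma eval_indet_minus: "eval_matrix_poly (indet_minus u) z = mat z - u"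
  by (simp add: eval_matrix_poly_def indet_minus_def map_matrix_def mat_def matrix2_simps)

text \<open>The embedding of constants is a ring homomorphism, so inverse complex matrices stay
  inverse to each other as matrix polynomials.\<close>

lemma map_matrix_const_mult:
  "map_matrix (\<lambda>c. [:c:]) (A ** B) =
    map_matrix (\<lambda>c. [:c:]) A ** map_matrix (\<lambda>c. [:c:]) (B :: complex ^ 2 ^ 2)"
  by (simp add: map_matrix_def matrix2_simps)

lemma map_matrix_const_mat_1: "map_matrix (\<lambda>c. [:c:]) (mat 1 :: complex ^ 2 ^ 2) = mat 1"
  by (simp add: map_matrix_def mat_def matrix2_simps pCons_one)

lemma det_mult_left_inverse:
  fixes A B :: "complex ^ 2 ^ 2"
  assumes "A ** B = mat 1"
  shows "det A * det B = 1"
  using assms by (metis det_I det_mul)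

lemma det_eq_0_iff_ker:
  fixes A :: "complex ^ 2 ^ 2"
  shows "det A = 0 \<longleftrightarrow> (\<exists>v. v \<noteq> 0 \<and> A *v v = 0)"
  using invertible_det_nz[of A] invertible_left_inverse[of A] matrix_left_invertible_ker[of A]
  by metis

text \<open>Some nonzero row of \<open>A\<close> annihilates both vectors, so the determinant of the
  pair \<open>v\<close>, \<open>w\<close> vanishes (\<open>cross\<close>); dividing by a nonzero
  coordinate of \<open>w\<close> gives the factor.\<close>

lemma kernel_vectors_parallel:
  fixes A :: "complex ^ 2 ^ 2"
  assumes "A \<noteq> 0" "A *v v = 0" "A *v w = 0" "w \<noteq> 0"
  obtains c where "v = c *s w"
proof -
  have cross: "v $ 1 * w $ 2 = v $ 2 * w $ 1"
  proof -
    have *: "v $ 1 * w $ 2 = v $ 2 * w $ 1"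
      if "a * v $ 1 + b * v $ 2 = 0" "a * w $ 1 + b * w $ 2 = 0" "a \<noteq> 0 \<or> b \<noteq> 0" for a b
      using that by algebra
    show ?thesis
      using assms(1-3) *[of "A $ 1 $ 1" "A $ 1 $ 2"] *[of "A $ 2 $ 1" "A $ 2 $ 2"]
      by (auto simp: matrix2_simps)
  qed
  show thesis
  proof (cases "w $ 1 = 0")
    case True
    with assms(4) cross have "v = (v $ 2 / w $ 2) *s w"
      by (auto simp: matrix2_simps)
    then show thesis by (rule that)
  next
    case False
    with cross have "v = (v $ 1 / w $ 1) *s w"
      by (auto simp: matrix2_simps field_simps)
    then show thesis by (rule that)
  qed
qed

lemma mat_of_columns_mult_vec: "mat_of_columns x y *v c = c $ 1 *s x + c $ 2 *s y"
  by (simp add: mat_of_columns_def transpose_def matrix2_simps mult.commute)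

lemma mult_mat_of_columns: "A ** mat_of_columns x y = mat_of_columns (A *v x) (A *v y)"
  by (simp add: mat_of_columns_def transpose_def matrix2_simps)

lemma mat_of_columns_mult_diag2:
  "mat_of_columns x y ** diag2 a b = mat_of_columns (a *s x) (b *s y)"
  by (simp add: mat_of_columns_def transpose_def diag2_def matrix2_simps mult.commute)

lemma matrix_inv:
  fixes A :: "'a::semiring_1 ^ 'n ^ 'm"
  assumes "invertible A"
  shows matrix_inv_right: "A ** matrix_inv A = mat 1"
    and matrix_inv_left: "matrix_inv A ** A = mat 1"
  using someI_ex[OF assms[unfolded invertible_def]] unfolding matrix_inv_def by auto

text \<open>Trades the formula for \<open>u\<close> for an equation without inverses, which can be
  checked column by column.\<close>

lemma mult_matrix_inv_eq:
  fixes Y :: "complex ^ 2 ^ 2"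
  assumes "invertible Y"
  shows "u = Y ** D ** matrix_inv Y \<longleftrightarrow> u ** Y = Y ** D"
  using matrix_inv_left[OF assms] matrix_inv_right[OF assms]
  by (metis matrix_mul_assoc matrix_mul_rid)

text \<open>This is the identity \<open>A ** adj A = mat (det A)\<close>, read one column at a
  time.\<close>

lemma column_adj_in_ker:
  fixes A :: "complex ^ 2 ^ 2"
  assumes "det A = 0" "y \<in> columns (adj A)"
  shows "A *v y = 0"
proof -
  from assms(2) obtain i where "y = column i (adj A)"
    by (auto simp: columns_def)
  with assms(1) exhaust_2[of i] show ?thesis
    by (auto simp: column_def adj_def matrix2_simps det_2 mult.commute)
qed

lemma mat_minus_mult_vec: "(mat z - u) *v v = z *s v - u *v (v :: complex ^ 2)"
  by (simp add: mat_def matrix2_simps algebra_simps)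

lemma conjugate_diag2_right_factor:
  assumes ker: "eval_matrix_poly P \<mu>\<^sub>1 *v y\<^sub>1 = 0" "eval_matrix_poly P \<mu>\<^sub>2 *v y\<^sub>2 = 0"
    and inv: "mat_of_columns y\<^sub>1 y\<^sub>2 ** Z = mat 1"
  shows "right_factor (indet_minus (mat_of_columns y\<^sub>1 y\<^sub>2 ** diag2 \<mu>\<^sub>1 \<mu>\<^sub>2 ** Z)) P"
proof -
  let ?C = "map_matrix (\<lambda>c. [:c:]) :: complex ^ 2 ^ 2 \<Rightarrow> _"
  let ?Y = "mat_of_columns y\<^sub>1 y\<^sub>2"
  define L :: matrix_poly where "L = vector [vector [[:- \<mu>\<^sub>1, 1:], 0], vector [0, [:- \<mu>\<^sub>2, 1:]]]"
  define M where "M = P ** ?C ?Y"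
  \<comment> \<open>Column \<open>j\<close> of \<open>M\<close>, evaluated at the
    \<open>j\<close>-th root, is the value of \<open>P\<close> there applied to the
    \<open>j\<close>-th kernel vector, hence zero; the factor theorem applies to each entry.\<close>
  have "[:- \<mu>\<^sub>1, 1:] dvd M $ i $ 1" "[:- \<mu>\<^sub>2, 1:] dvd M $ i $ 2" for i
    using ker exhaust_2[of i]
    by (auto simp: M_def poly_eq_0_iff_dvd[symmetric] eval_matrix_poly_def map_matrix_def
        mat_of_columns_def transpose_def matrix2_simps mult.commute)
  note div = this[THEN dvd_div_mult_self]
  define Q where "Q = (\<chi> i j. M $ i $ j div L $ j $ j)"
  \<comment> \<open>The deleted rules would expand the products with linear factors, and
    \<open>div\<close> would no longer match.\<close>
  have "M = Q ** L"
    by (simp add: Q_def L_def vec_eq_iff forall_2 matrix_matrix_mult_def sum_2 div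
        del: mult_pCons_left mult_pCons_right)
  then have Q: "P ** ?C ?Y = Q ** L"
    by (simp only: M_def)
  have CYZ: "?C ?Y ** ?C Z = mat 1"
    by (metis inv map_matrix_const_mat_1 map_matrix_const_mult)
  have ZY: "Z ** ?Y = mat 1"
    using inv matrix_left_right_inverse by blast
  have CZY: "?C Z ** ?C ?Y = mat 1"
    by (metis ZY map_matrix_const_mat_1 map_matrix_const_mult)
  have "L = mat [:0, 1:] - ?C (diag2 \<mu>\<^sub>1 \<mu>\<^sub>2)"
    by (simp add: L_def diag2_def mat_def map_matrix_def matrix2_simps)
  \<comment> \<open>The indeterminate is a scalar matrix, hence central: conjugating
    \<open>L\<close> by \<open>?C ?Y\<close> changes only its constant term.\<close>
  moreover have "?C ?Y ** mat [:0, 1:] = mat [:0, 1:] ** ?C ?Y"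
    by (simp add: mat_def matrix2_simps)
  ultimately have "?C ?Y ** L ** ?C Z =
      mat [:0, 1:] ** ?C ?Y ** ?C Z - ?C ?Y ** ?C (diag2 \<mu>\<^sub>1 \<mu>\<^sub>2) ** ?C Z"
    by (simp only: matrix_sub_ldistrib matrix_sub_rdistrib)
  also have "mat [:0, 1:] ** ?C ?Y ** ?C Z = mat [:0, 1:]"
    by (simp only: CYZ matrix_mul_rid flip: matrix_mul_assoc)
  finally have "indet_minus (?Y ** diag2 \<mu>\<^sub>1 \<mu>\<^sub>2 ** Z) = ?C ?Y ** L ** ?C Z"
    by (simp only: indet_minus_def map_matrix_const_mult)
  also have "\<dots> = ?C ?Y ** (L ** ?C Z)"
    by (simp only: matrix_mul_assoc)
  \<comment> \<open>The cofactor \<open>Q ** ?C Z\<close> is chosen so that \<open>?C Z\<close>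
    cancels the leading \<open>?C ?Y\<close>; what remains is \<open>Q ** L ** ?C Z\<close>.\<close>
  finally have "Q ** ?C Z ** indet_minus (?Y ** diag2 \<mu>\<^sub>1 \<mu>\<^sub>2 ** Z) =
      Q ** (?C Z ** ?C ?Y) ** L ** ?C Z"
    by (simp only: matrix_mul_assoc)
  also have "\<dots> = P ** ?C ?Y ** ?C Z"
    by (simp only: CZY matrix_mul_rid Q)
  also have "\<dots> = P"
    by (simp only: CYZ matrix_mul_rid flip: matrix_mul_assoc)
  finally have "P = (Q ** ?C Z) ** indet_minus (?Y ** diag2 \<mu>\<^sub>1 \<mu>\<^sub>2 ** Z)" ..
  then show ?thesis
    unfolding right_factor_def by blast
qed

text \<open>Similar matrices have the same characteristic polynomial. Only its zeros matter here, so
  it is computed at each complex \<open>z\<close>, where the determinants of \<open>Y\<close> and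
  \<open>Z\<close> cancel.\<close>

lemma roots_det_conjugate_diag2:
  assumes "Y ** Z = mat 1"
  shows "roots (det (indet_minus (Y ** diag2 a b ** Z))) = {a, b}"
proof -
  have *: "mat z - Y ** diag2 a b ** Z = Y ** diag2 (z - a) (z - b) ** Z" for z
  proof -
    have "diag2 (z - a) (z - b) = mat z - diag2 a b"
      by (simp add: diag2_def mat_def matrix2_simps)
    moreover have "Y ** mat z = mat z ** Y"
      by (simp add: mat_def matrix2_simps)
    ultimately have "Y ** diag2 (z - a) (z - b) ** Z = mat z ** Y ** Z - Y ** diag2 a b ** Z"
      by (simp only: matrix_sub_ldistrib matrix_sub_rdistrib)
    also have "mat z ** Y ** Z = mat z"
      by (simp only: assms matrix_mul_rid flip: matrix_mul_assoc)
    finally show ?thesis ..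
  qed
  have "det (mat z - Y ** diag2 a b ** Z) = (z - a) * (z - b)" for z
    using det_mult_left_inverse[OF assms] unfolding *
    by (simp add: det_mul) (simp add: det_2 diag2_def)
  then show ?thesis
    by (auto simp: roots_def eval_indet_minus simp flip: det_eval_matrix_poly)
qed

text \<open>An eigenvector \<open>w\<close> of \<open>u\<close> for \<open>z\<close> is also killed
  by the value of \<open>P\<close> at \<open>z\<close>. That value is nonzero, so its kernel is at
  most a line and \<open>y\<close> is a multiple of \<open>w\<close>.\<close>

lemma right_factor_eigenvector:
  assumes "right_factor (indet_minus u) P" "z \<in> roots (det (indet_minus u))"
    and "eval_matrix_poly P z *v y = 0" "eval_matrix_poly P z \<noteq> 0"
  shows "u *v y = z *s y"
proof -
  from assms(2) have "det (mat z - u) = 0"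
    by (simp add: roots_def eval_indet_minus flip: det_eval_matrix_poly)
  then obtain w where w: "w \<noteq> 0" "(mat z - u) *v w = 0"
    by (auto simp: det_eq_0_iff_ker)
  from assms(1) obtain Q where "P = Q ** indet_minus u"
    unfolding right_factor_def by blast
  then have "eval_matrix_poly P z = eval_matrix_poly Q z ** (mat z - u)"
    by (simp add: eval_matrix_poly_mult eval_indet_minus)
  with w(2) have "eval_matrix_poly P z *v w = 0"
    by (simp flip: matrix_vector_mul_assoc)
  with assms(3,4) w(1) obtain c where "y = c *s w"
    using kernel_vectors_parallel by metis
  then have "(mat z - u) *v y = 0"
    using w(2) by (simp add: vector_scalar_commute)
  then show ?thesis
    by (simp add: mat_minus_mult_vec)
qed

text \<open>Arbitrary nonzero kernel vectors replace the adjugate columns. The equivalence then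
  yields existence and uniqueness at once, and the explicit formula for every choice of
  columns.\<close>

lemma independent_roots_kernel_basis:
  assumes "independent_roots P \<mu>\<^sub>1 \<mu>\<^sub>2"
    and "eval_matrix_poly P \<mu>\<^sub>1 *v y\<^sub>1 = 0" "y\<^sub>1 \<noteq> 0"
    and "eval_matrix_poly P \<mu>\<^sub>2 *v y\<^sub>2 = 0" "y\<^sub>2 \<noteq> 0"
  shows "invertible (mat_of_columns y\<^sub>1 y\<^sub>2)"
    and "right_factor (indet_minus u) P \<and> roots (det (indet_minus u)) = {\<mu>\<^sub>1, \<mu>\<^sub>2} \<longleftrightarrow>
      u = mat_of_columns y\<^sub>1 y\<^sub>2 ** diag2 \<mu>\<^sub>1 \<mu>\<^sub>2 ** matrix_inv (mat_of_columns y\<^sub>1 y\<^sub>2)"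
proof -
  let ?Y = "mat_of_columns y\<^sub>1 y\<^sub>2"
  have disj: "v = 0" if "eval_matrix_poly P \<mu>\<^sub>1 *v v = 0" "eval_matrix_poly P \<mu>\<^sub>2 *v v = 0" for v
    using assms(1) that unfolding independent_roots_def ker_def by blast
  have "c = 0" if "?Y *v c = 0" for c
  proof -
    have eq: "c $ 1 *s y\<^sub>1 = (- c $ 2) *s y\<^sub>2"
      using that by (simp add: mat_of_columns_mult_vec eq_neg_iff_add_eq_0)
    \<comment> \<open>By \<open>eq\<close> this vector is a multiple of both
      \<open>y\<^sub>1\<close> and \<open>y\<^sub>2\<close>, so it lies in both kernels.\<close>
    have "c $ 1 *s y\<^sub>1 = 0"
    proof (rule disj)
      show "eval_matrix_poly P \<mu>\<^sub>1 *v (c $ 1 *s y\<^sub>1) = 0"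
        by (simp add: vector_scalar_commute assms(2))
      show "eval_matrix_poly P \<mu>\<^sub>2 *v (c $ 1 *s y\<^sub>1) = 0"
        unfolding eq by (simp only: vector_scalar_commute assms(4)) simp
    qed
    with eq assms(3,5) show "c = 0"
      by (simp add: vec_eq_iff[of c] forall_2)
  qed
  then show inv: "invertible ?Y"
    by (metis det_eq_0_iff_ker invertible_det_nz)
  \<comment> \<open>If one of the two values were zero, the kernel vector at the other root would
    lie in both kernels.\<close>
  have nz: "eval_matrix_poly P \<mu>\<^sub>1 \<noteq> 0" "eval_matrix_poly P \<mu>\<^sub>2 \<noteq> 0"
    using disj[of y\<^sub>2] disj[of y\<^sub>1] assms(2-5) by auto
  show "right_factor (indet_minus u) P \<and> roots (det (indet_minus u)) = {\<mu>\<^sub>1, \<mu>\<^sub>2} \<longleftrightarrow>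
      u = ?Y ** diag2 \<mu>\<^sub>1 \<mu>\<^sub>2 ** matrix_inv ?Y"
  proof
    assume "right_factor (indet_minus u) P \<and> roots (det (indet_minus u)) = {\<mu>\<^sub>1, \<mu>\<^sub>2}"
    then have "u *v y\<^sub>1 = \<mu>\<^sub>1 *s y\<^sub>1" "u *v y\<^sub>2 = \<mu>\<^sub>2 *s y\<^sub>2"
      using right_factor_eigenvector assms(2,4) nz by auto
    then show "u = ?Y ** diag2 \<mu>\<^sub>1 \<mu>\<^sub>2 ** matrix_inv ?Y"
      unfolding mult_matrix_inv_eq[OF inv]
      by (simp add: mult_mat_of_columns mat_of_columns_mult_diag2)
  next
    assume "u = ?Y ** diag2 \<mu>\<^sub>1 \<mu>\<^sub>2 ** matrix_inv ?Y"
    then show "right_factor (indet_minus u) P \<and> roots (det (indet_minus u)) = {\<mu>\<^sub>1, \<mu>\<^sub>2}"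
      using conjugate_diag2_right_factor roots_det_conjugate_diag2 assms(2,4)
        matrix_inv_right[OF inv] by auto
  qed
qed

text \<open>Independent roots are distinct, since a single root already has a nonzero kernel vector;
  the set equation therefore determines both zeros of the quadratic
  \<open>det (indet_minus u)\<close>.\<close>

theorem theorem2p23:
  fixes P :: matrix_poly and \<mu>\<^sub>1 \<mu>\<^sub>2 :: complex
  assumes "independent_roots P \<mu>\<^sub>1 \<mu>\<^sub>2"
  shows "(\<exists>!u. right_factor (indet_minus u) P \<and> roots (det (indet_minus u)) = {\<mu>\<^sub>1, \<mu>\<^sub>2}) \<and>
    (\<forall>u y\<^sub>1 y\<^sub>2.
      right_factor (indet_minus u) P \<and> roots (det (indet_minus u)) = {\<mu>\<^sub>1, \<mu>\<^sub>2} \<and>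
      y\<^sub>1 \<in> columns (adj (eval_matrix_poly P \<mu>\<^sub>1)) \<and> y\<^sub>1 \<noteq> 0 \<and>
      y\<^sub>2 \<in> columns (adj (eval_matrix_poly P \<mu>\<^sub>2)) \<and> y\<^sub>2 \<noteq> 0 \<longrightarrow>
      invertible (mat_of_columns y\<^sub>1 y\<^sub>2) \<and>
      u = mat_of_columns y\<^sub>1 y\<^sub>2 ** diag2 \<mu>\<^sub>1 \<mu>\<^sub>2 ** matrix_inv (mat_of_columns y\<^sub>1 y\<^sub>2))"
proof -
  have det: "det (eval_matrix_poly P \<mu>\<^sub>1) = 0" "det (eval_matrix_poly P \<mu>\<^sub>2) = 0"
    using assms by (simp_all add: independent_roots_def roots_def det_eval_matrix_poly)
  then obtain v\<^sub>1 v\<^sub>2 where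
    "eval_matrix_poly P \<mu>\<^sub>1 *v v\<^sub>1 = 0" "v\<^sub>1 \<noteq> 0" "eval_matrix_poly P \<mu>\<^sub>2 *v v\<^sub>2 = 0" "v\<^sub>2 \<noteq> 0"
    by (auto simp: det_eq_0_iff_ker)
  \<comment> \<open>For the fixed pair \<open>v\<^sub>1\<close>, \<open>v\<^sub>2\<close> the
    condition on \<open>u\<close> is equivalent to \<open>u\<close> being one explicit
    matrix.\<close>
  then have "\<exists>!u. right_factor (indet_minus u) P \<and> roots (det (indet_minus u)) = {\<mu>\<^sub>1, \<mu>\<^sub>2}"
    using independent_roots_kernel_basis(2)[OF assms] by simp
  moreover have "invertible (mat_of_columns y\<^sub>1 y\<^sub>2) \<and>
      u = mat_of_columns y\<^sub>1 y\<^sub>2 ** diag2 \<mu>\<^sub>1 \<mu>\<^sub>2 ** matrix_inv (mat_of_columns y\<^sub>1 y\<^sub>2)"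
    if "right_factor (indet_minus u) P \<and> roots (det (indet_minus u)) = {\<mu>\<^sub>1, \<mu>\<^sub>2}"
      and "y\<^sub>1 \<in> columns (adj (eval_matrix_poly P \<mu>\<^sub>1))" "y\<^sub>1 \<noteq> 0"
      and "y\<^sub>2 \<in> columns (adj (eval_matrix_poly P \<mu>\<^sub>2))" "y\<^sub>2 \<noteq> 0" for u y\<^sub>1 y\<^sub>2
    using that independent_roots_kernel_basis[OF assms, of y\<^sub>1 y\<^sub>2] column_adj_in_ker det by blast
  ultimately show ?thesis
    by blast
qed

end
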